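(* Let $T:M\to M$ be a piecewise continuous map with discontinuity set $H$, let $H_\varepsilon=\{x\in M:\mathrm{dist}(x,H)<\varepsilon\}$ and $\Omega=\bigcup_{j=0}^\infty T^{-j}(H)$. Assume that there exists a point $x\in M\setminus\Omega$ such that $$\lim_{\varepsilon\to0}\ \limsup_{m\to\infty}\ \frac1m\,\#\{1\le k\le m:\ T^k(x)\in H_\varepsilon\}=0.$$ Then $T$ admits a $T$-invariant Borel probability measure.
   Context: $M$ is a $d$-dimensional compact Riemannian manifold with distance $\mathrm{dist}$, or a bounded subset of $\mathbb{R}^d$, that is represented as a finite union of closures of pairwise disjoint domains $M_1,\ldots,M_n$. A map $T:M\to M$ is piecewise continuous (with respect to this partition) if all restrictions $T|_{M_j}$ are continuous. The (compact) discontinuity set is $H=\bigcup_{j=1}^n\partial M_j$. A Borel probability measure $\mu$ is $T$-invariant if $\mu(T^{-1}(A))=\mu(A)$ for every measurable set $A$. *)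

theory Defs
  imports "HOL-Probability.Probability"
begin

primrec Ck_on ::
    "nat \<Rightarrow> ('u::euclidean_space \<Rightarrow> 'v::euclidean_space) \<Rightarrow> 'u set \<Rightarrow> bool" where
  "Ck_on 0 f S \<longleftrightarrow> continuous_on S f"
| "Ck_on (Suc k) f S \<longleftrightarrow>
     f differentiable_on S \<and> (\<forall>v. Ck_on k (\<lambda>x. frechet_derivative f (at x) v) S)"

(* Only used for open S. *)
definition smooth_on :: "('u::euclidean_space \<Rightarrow> 'v::euclidean_space) \<Rightarrow> 'u set \<Rightarrow> bool" where
  "smooth_on f S \<longleftrightarrow> (\<forall>k. Ck_on k f S)"

type_synonym ('a, 'd) chart = "'a set \<times> ('a \<Rightarrow> real ^ 'd)"

definition smooth_atlas :: "'a::metric_space set \<Rightarrow> ('a, 'd::finite) chart set \<Rightarrow> bool" where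
  "smooth_atlas M \<A> \<longleftrightarrow>
     (\<Union>(U, \<phi>)\<in>\<A>. U) = M \<and>
     (\<forall>(U, \<phi>)\<in>\<A>. openin (top_of_set M) U \<and> open (\<phi> ` U) \<and>
        homeomorphism U (\<phi> ` U) \<phi> (inv_into U \<phi>)) \<and>
     (\<forall>(U, \<phi>)\<in>\<A>. \<forall>(V, \<psi>)\<in>\<A>. smooth_on (\<psi> \<circ> inv_into U \<phi>) (\<phi> ` (U \<inter> V)))"

(* A Riemannian metric is given by its coordinate expressions: g (U, phi) p is the inner product
   on the tangent space at p \<in> U, read in the coordinates of the chart (U, phi).  The last
   clause is the transformation rule of a covariant 2-tensor under a change of chart. *)
definition riemannian_metric ::
    "('a, 'd::finite) chart set \<Rightarrow>
     (('a, 'd) chart \<Rightarrow> 'a \<Rightarrow> real ^ 'd \<Rightarrow> real ^ 'd \<Rightarrow> real) \<Rightarrow> bool" where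
  "riemannian_metric \<A> g \<longleftrightarrow>
     (\<forall>(U, \<phi>)\<in>\<A>. \<forall>p\<in>U.
        bilinear (g (U, \<phi>) p) \<and>
        (\<forall>v w. g (U, \<phi>) p v w = g (U, \<phi>) p w v) \<and>
        (\<forall>v. v \<noteq> 0 \<longrightarrow> 0 < g (U, \<phi>) p v v)) \<and>
     (\<forall>(U, \<phi>)\<in>\<A>. \<forall>v w. smooth_on (\<lambda>u. g (U, \<phi>) (inv_into U \<phi> u) v w) (\<phi> ` U)) \<and>
     (\<forall>(U, \<phi>)\<in>\<A>. \<forall>(V, \<psi>)\<in>\<A>. \<forall>p \<in> U \<inter> V. \<forall>v w.
        g (U, \<phi>) p v w =
          g (V, \<psi>) p (frechet_derivative (\<psi> \<circ> inv_into U \<phi>) (at (\<phi> p)) v)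
                      (frechet_derivative (\<psi> \<circ> inv_into U \<phi>) (at (\<phi> p)) w))"

(* c is a piecewise C^1 curve in M, parametrised by [0,1], and L is the integral of its
   Riemannian speed s. *)
definition riemannian_curve_length ::
    "'a::metric_space set \<Rightarrow> ('a, 'd::finite) chart set \<Rightarrow>
     (('a, 'd) chart \<Rightarrow> 'a \<Rightarrow> real ^ 'd \<Rightarrow> real ^ 'd \<Rightarrow> real) \<Rightarrow>
     (real \<Rightarrow> 'a) \<Rightarrow> real \<Rightarrow> bool" where
  "riemannian_curve_length M \<A> g c L \<longleftrightarrow>
     continuous_on {0..1} c \<and> c ` {0..1} \<subseteq> M \<and>
     (\<exists>K s. finite K \<and> (s has_integral L) {0..1} \<and>
        (\<forall>(U, \<phi>)\<in>\<A>.
           (\<phi> \<circ> c) C1_differentiable_on {t \<in> {0<..<1} - K. c t \<in> U} \<and>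
           (\<forall>t \<in> {0<..<1} - K. c t \<in> U \<longrightarrow>
              s t = sqrt (g (U, \<phi>) (c t) (vector_derivative (\<phi> \<circ> c) (at t))
                                        (vector_derivative (\<phi> \<circ> c) (at t))))))"

(* The metric of the ambient type, restricted to M, is the Riemannian distance (and, by
   smooth_atlas, it induces the manifold topology).  M need not be connected; the distance of
   points that are not joined by a curve is left free, since there is no canonical choice. *)
definition compact_riemannian_manifold ::
    "'a::metric_space set \<Rightarrow> ('a, 'd::finite) chart set \<Rightarrow>
     (('a, 'd) chart \<Rightarrow> 'a \<Rightarrow> real ^ 'd \<Rightarrow> real ^ 'd \<Rightarrow> real) \<Rightarrow> bool" where
  "compact_riemannian_manifold M \<A> g \<longleftrightarrow>
     compact M \<and> smooth_atlas M \<A> \<and> riemannian_metric \<A> g \<and>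
     (\<forall>x\<in>M. \<forall>y\<in>M.
        let lengths = {L. \<exists>c. riemannian_curve_length M \<A> g c L \<and> c 0 = x \<and> c 1 = y}
        in lengths \<noteq> {} \<longrightarrow> dist x y = Inf lengths)"

(* E is the space in which domains, closures and boundaries are taken: E = M for a manifold,
   E = UNIV for a subset of Euclidean space. *)
definition domain_decomposition ::
    "'a::metric_space set \<Rightarrow> 'a set \<Rightarrow> nat \<Rightarrow> (nat \<Rightarrow> 'a set) \<Rightarrow> bool" where
  "domain_decomposition E M n D \<longleftrightarrow>
     (\<forall>j\<in>{1..n}. D j \<noteq> {} \<and> openin (top_of_set E) (D j) \<and> connected (D j)) \<and>
     disjoint_family_on D {1..n} \<and>
     M = (\<Union>j\<in>{1..n}. top_of_set E closure_of D j)"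

definition discontinuity_set ::
    "'a::metric_space set \<Rightarrow> nat \<Rightarrow> (nat \<Rightarrow> 'a set) \<Rightarrow> 'a set" where
  "discontinuity_set E n D = (\<Union>j\<in>{1..n}. top_of_set E frontier_of D j)"

(* No condition on T on the boundaries of the domains. *)
definition piecewise_continuous ::
    "'a::metric_space set \<Rightarrow> nat \<Rightarrow> (nat \<Rightarrow> 'a set) \<Rightarrow> ('a \<Rightarrow> 'a) \<Rightarrow> bool" where
  "piecewise_continuous M n D T \<longleftrightarrow>
     T \<in> M \<rightarrow> M \<and> (\<forall>j\<in>{1..n}. continuous_on (D j) T)"

(* Not phrased with infdist, because infdist x {} = 0 whereas the distance to the empty set
   should be infinite. *)
definition nbhd_within :: "'a::metric_space set \<Rightarrow> 'a set \<Rightarrow> real \<Rightarrow> 'a set" where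
  "nbhd_within M H \<epsilon> = {x \<in> M. \<exists>y\<in>H. dist x y < \<epsilon>}"

definition preimages_union :: "'a set \<Rightarrow> ('a \<Rightarrow> 'a) \<Rightarrow> 'a set \<Rightarrow> 'a set" where
  "preimages_union M T H = (\<Union>j. {x \<in> M. (T ^^ j) x \<in> H})"

definition visit_frequency :: "('a \<Rightarrow> 'a) \<Rightarrow> 'a \<Rightarrow> 'a set \<Rightarrow> nat \<Rightarrow> real" where
  "visit_frequency T x A m = real (card {k \<in> {1..m}. (T ^^ k) x \<in> A}) / real m"

(* T is arbitrary on the discontinuity set, so the preimage of a Borel set A need not be Borel;
   it is required to be measurable for the completion of the measure. *)
definition invariant_borel_probability ::
    "'a::metric_space set \<Rightarrow> ('a \<Rightarrow> 'a) \<Rightarrow> 'a measure \<Rightarrow> bool" where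
  "invariant_borel_probability M T \<mu> \<longleftrightarrow>
     prob_space \<mu> \<and> sets \<mu> = sets (restrict_space borel M) \<and>
     (\<forall>A \<in> sets \<mu>. T -` A \<inter> M \<in> sets (completion \<mu>) \<and>
        emeasure (completion \<mu>) (T -` A \<inter> M) = emeasure \<mu> A)"

lemma invariant_borel_probability_measurable:
  assumes "T \<in> restrict_space borel M \<rightarrow>\<^sub>M restrict_space borel M"
  shows "invariant_borel_probability M T \<mu> \<longleftrightarrow>
    prob_space \<mu> \<and> sets \<mu> = sets (restrict_space borel M) \<and>
    (\<forall>A \<in> sets \<mu>. emeasure \<mu> (T -` A \<inter> M) = emeasure \<mu> A)"
proof -
  have "T -` A \<inter> M \<in> sets \<mu>" if "sets \<mu> = sets (restrict_space borel M)" "A \<in> sets \<mu>" for A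
    using measurable_sets[OF assms, of A] that by (simp add: space_restrict_space)
  then show ?thesis
    unfolding invariant_borel_probability_def
    by (auto simp: emeasure_completion sets_completionI_sets)
qed

end

(* The visit frequencies of the orbit of x have a cluster point m in the compact space [0,1]^Pow,
   which is a finitely additive T-invariant probability on all sets.  As for a content in the proof
   of the Riesz representation theorem, m is regularised to an outer regular Borel measure mu with
   mu U = sup {m K | K compact, K <= U} for open U.  The hypothesis makes the neighbourhoods of H
   have small m-measure, so mu H = 0.  If K is compact and disjoint from H, then T K is compact, and
   m K <= m (T^-1 (T K)) = m (T K).  Taking suprema and using mu H = 0 gives mu (T^-1 U) <= mu U for
   open U; by outer regularity this extends to all Borel sets, and taking complements gives
   equality. *)

theory Submission
  imports Defs
begin

section \<open>Simultaneous limits by compactness of products\<close>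

text \<open>Tychonoff's theorem yields a cluster point \<open>l\<close> of \<open>f\<close> in the
  product of the \<open>K i\<close>. The index type may be uncountable, so a convergent subsequence
  need not exist; a finer filter takes its place.\<close>

lemma convergent_subfilter_pointwise:
  fixes f :: "'n \<Rightarrow> 'i \<Rightarrow> 'b::topological_space"
  assumes "F \<noteq> bot" and K: "\<And>i. compact (K i)" and f: "\<And>n i. f n i \<in> K i"
  obtains l G where "G \<noteq> bot" "G \<le> F" "\<And>i. ((\<lambda>n. f n i) \<longlongrightarrow> l i) G"
proof -
  have "compactin (product_topology (\<lambda>i. euclidean) UNIV) (PiE UNIV K)"
    using K by (subst compactin_PiE) simp
  then have "compact (PiE UNIV K)"
    by (simp add: euclidean_product_topology)
  moreover have "filtermap f F \<noteq> bot" "eventually (\<lambda>h. h \<in> PiE UNIV K) (filtermap f F)"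
    using \<open>F \<noteq> bot\<close> f
    by (auto simp: filtermap_bot_iff eventually_filtermap PiE_UNIV_domain)
  ultimately obtain l where l: "inf (nhds l) (filtermap f F) \<noteq> bot"
    unfolding compact_filter by meson
  \<comment> \<open>The coarsest filter below \<open>F\<close> along which \<open>f\<close> tends to
    \<open>l\<close>; it is proper because \<open>l\<close> is a cluster point.\<close>
  define G where "G = inf F (filtercomap f (nhds l))"
  have "G \<noteq> bot"
  proof
    assume "G = bot"
    then have "eventually (\<lambda>_. False) G" by simp
    then obtain P Q where PQ: "eventually P F" "eventually Q (nhds l)" "\<And>n. P n \<Longrightarrow> Q (f n) \<Longrightarrow> False"
      unfolding G_def eventually_inf eventually_filtercomap by blast
    have "eventually (\<lambda>h. \<not> Q h) (filtermap f F)"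
      using PQ(1) unfolding eventually_filtermap by eventually_elim (use PQ(3) in blast)
    with PQ(2) have "eventually (\<lambda>_. False) (inf (nhds l) (filtermap f F))"
      unfolding eventually_inf by blast
    with l show False by (simp add: trivial_limit_def)
  qed
  moreover have "G \<le> F" by (simp add: G_def)
  moreover have "((\<lambda>n. f n i) \<longlongrightarrow> l i) G" for i
  proof -
    have "filterlim f (nhds l) G"
      unfolding G_def by (rule filterlim_mono[OF filterlim_filtercomap]) auto
    then show ?thesis
      using continuous_on_tendsto_compose[OF continuous_on_product_coordinates] by fastforce
  qed
  ultimately show thesis by (rule that)
qed

section \<open>From a content to an outer regular Borel measure\<close>

text \<open>Meant for open \<open>U\<close>. A finitely additive \<open>m\<close> need not be
  countably additive; rebuilding the values of open sets from compact subsets makes open covers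
  finite, which yields countable subadditivity.\<close>

definition inner_content :: "('a::topological_space set \<Rightarrow> ennreal) \<Rightarrow> 'a set \<Rightarrow> ennreal" where
  "inner_content m U = (SUP K\<in>{K. compact K \<and> K \<subseteq> U}. m K)"

definition outer_content :: "('a::topological_space set \<Rightarrow> ennreal) \<Rightarrow> 'a set \<Rightarrow> ennreal" where
  "outer_content m A = (INF U\<in>{U. open U \<and> A \<subseteq> U}. inner_content m U)"

lemma inner_content_upper: "compact K \<Longrightarrow> K \<subseteq> U \<Longrightarrow> m K \<le> inner_content m U"
  by (auto simp: inner_content_def intro: SUP_upper)

lemma inner_content_mono: "U \<subseteq> V \<Longrightarrow> inner_content m U \<le> inner_content m V"
  unfolding inner_content_def by (rule SUP_subset_mono) auto

lemma outer_content_upper: "open U \<Longrightarrow> A \<subseteq> U \<Longrightarrow> outer_content m A \<le> inner_content m U"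
  by (auto simp: outer_content_def intro: INF_lower)

lemma outer_content_mono: "A \<subseteq> B \<Longrightarrow> outer_content m A \<le> outer_content m B"
  unfolding outer_content_def by (rule INF_superset_mono) auto

lemma outer_content_open: "open U \<Longrightarrow> outer_content m U = inner_content m U"
  unfolding outer_content_def by (intro INF_eqI inner_content_mono) auto

text \<open>Classically a content is given on compact sets only; here every set has a value, as is
  the case for visit frequencies.\<close>

locale content =
  fixes m :: "'a::metric_space set \<Rightarrow> ennreal"
  assumes empty: "m {} = 0"
    and subadditive: "m (A \<union> B) \<le> m A + m B"
    and additive: "A \<inter> B = {} \<Longrightarrow> m (A \<union> B) = m A + m B"
begin

lemma mono: "A \<subseteq> B \<Longrightarrow> m A \<le> m B"
  using additive[of A "B - A"] by (simp add: Un_absorb1)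

lemma inner_content_le: "inner_content m U \<le> m U"
  unfolding inner_content_def by (intro SUP_least) (auto intro: mono)

lemma UN_le: "finite I \<Longrightarrow> m (\<Union>i\<in>I. A i) \<le> (\<Sum>i\<in>I. m (A i))"
proof (induction I rule: finite_induct)
  case (insert i I)
  have "m (\<Union>j\<in>insert i I. A j) \<le> m (A i) + m (\<Union>j\<in>I. A j)"
    using subadditive by simp
  also have "\<dots> \<le> m (A i) + (\<Sum>j\<in>I. m (A j))"
    by (intro add_left_mono insert.IH)
  finally show ?case using insert by simp
qed (simp add: empty)

text \<open>A compact subset of the union splits into finitely many compact pieces, each inside a
  single \<open>U i\<close>, and finite subadditivity applies to them.\<close>

lemma inner_content_UN_le:
  fixes U :: "nat \<Rightarrow> 'a set"
  assumes U: "\<And>i. open (U i)"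
  shows "inner_content m (\<Union>i. U i) \<le> (\<Sum>i. inner_content m (U i))"
  unfolding inner_content_def[of _ "\<Union>i. U i"]
proof (intro SUP_least, clarify)
  fix K assume K: "compact K" "K \<subseteq> (\<Union>i. U i)"
  have "\<exists>i r. r > 0 \<and> cball p r \<subseteq> U i" if "p \<in> K" for p
    using K(2) that U open_contains_cball by (metis UN_E subsetD)
  then obtain i r where ir: "\<And>p. p \<in> K \<Longrightarrow> r p > 0 \<and> cball p (r p) \<subseteq> U (i p)"
    by metis
  obtain P where P: "P \<subseteq> K" "finite P" "K \<subseteq> (\<Union>p\<in>P. ball p (r p))"
  proof (rule compactE_image[OF K(1), of K "\<lambda>p. ball p (r p)"])
    show "K \<subseteq> (\<Union>p\<in>K. ball p (r p))" using ir by force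
  qed auto
  \<comment> \<open>Piece \<open>L j\<close> collects the balls of the finite cover that were
    assigned to \<open>U j\<close>. Closed balls keep it compact, and their radii keep it inside
    \<open>U j\<close>.\<close>
  define L where "L j = K \<inter> (\<Union>p\<in>{p\<in>P. i p = j}. cball p (r p))" for j
  have L: "compact (L j)" "L j \<subseteq> U j" for j
    using P ir K(1) by (auto simp: L_def intro!: compact_Int_closed closed_UN)
  have "K \<subseteq> (\<Union>j\<in>i`P. L j)"
    using P(3) by (fastforce simp: L_def)
  then have "K = (\<Union>j\<in>i`P. L j)" by (auto simp: L_def)
  then have "m K \<le> (\<Sum>j\<in>i`P. m (L j))"
    using UN_le[of "i`P" L] P(2) by simp
  also have "\<dots> \<le> (\<Sum>j\<in>i`P. inner_content m (U j))"
    by (intro sum_mono inner_content_upper L)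
  also have "\<dots> \<le> (\<Sum>j. inner_content m (U j))"
    using P(2) by (intro sum_le_suminf) auto
  finally show "m K \<le> (\<Sum>j. inner_content m (U j))" .
qed

lemma outer_content_UN_le:
  fixes A :: "nat \<Rightarrow> 'a set"
  shows "outer_content m (\<Union>i. A i) \<le> (\<Sum>i. outer_content m (A i))"
proof (rule ennreal_le_epsilon)
  fix e :: real
  assume e: "0 < e" and fin: "(\<Sum>i. outer_content m (A i)) < top"
  \<comment> \<open>The tolerances e * (1/2)^(i+1) sum to \<open>e\<close>.\<close>
  have "\<exists>U. open U \<and> A i \<subseteq> U \<and> inner_content m U < outer_content m (A i) + ennreal (e * (1/2)^Suc i)" for i
  proof -
    have "outer_content m (A i) < top"
      using fin ennreal_suminf_lessD by blast
    then have "outer_content m (A i) \<noteq> \<infinity>" by simp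
    then have "\<exists>U\<in>{U. open U \<and> A i \<subseteq> U}. inner_content m U < outer_content m (A i) + ennreal (e * (1/2)^Suc i)"
      using e by (intro INF_approx_ennreal) (simp_all add: outer_content_def)
    then show ?thesis by blast
  qed
  then obtain U where U: "\<And>i. open (U i)" "\<And>i. A i \<subseteq> U i"
      "\<And>i. inner_content m (U i) \<le> outer_content m (A i) + ennreal (e * (1/2)^Suc i)"
    by (metis less_imp_le)
  have "outer_content m (\<Union>i. A i) \<le> inner_content m (\<Union>i. U i)"
    using U by (intro outer_content_upper) auto
  also have "\<dots> \<le> (\<Sum>i. inner_content m (U i))"
    by (rule inner_content_UN_le) (rule U)
  also have "\<dots> \<le> (\<Sum>i. outer_content m (A i) + ennreal (e * (1/2)^Suc i))"
    by (intro suminf_le U) auto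
  also have "\<dots> = (\<Sum>i. outer_content m (A i)) + (\<Sum>i. ennreal (e * (1/2)^Suc i))"
    by (intro suminf_add[symmetric]) auto
  also have "(\<Sum>i. ennreal (e * (1/2)^Suc i)) = ennreal e"
    using e sums_mult[OF power_half_series, of e] by (intro suminf_ennreal_eq) auto
  finally show "outer_content m (\<Union>i. A i) \<le> (\<Sum>i. outer_content m (A i)) + ennreal e" .
qed

lemma outer_measure_space_outer_content: "outer_measure_space UNIV (outer_content m)"
proof -
  have "outer_content m {} = 0"
    by (simp add: outer_content_open inner_content_def empty)
  then show ?thesis
    by (auto simp: outer_measure_space_def positive_def increasing_def countably_subadditive_def
        outer_content_mono outer_content_UN_le)
qed

text \<open>For an open \<open>V\<close> containing \<open>A\<close>, exhaust V \<inter> U by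
  compact \<open>K\<close>, then the open set V - K by compact \<open>L\<close>. Since
  \<open>K\<close> and \<open>L\<close> are disjoint and their union is a compact subset of
  \<open>V\<close>, additivity of \<open>m\<close> gives the nontrivial half of Caratheodory's
  condition.\<close>

lemma open_in_lambda_system:
  assumes U: "open U"
  shows "U \<in> lambda_system UNIV UNIV (outer_content m)"
proof -
  have "outer_content m (A \<inter> U) + outer_content m (A - U) \<le> outer_content m A" for A
    unfolding outer_content_def[of m A]
  proof (intro INF_greatest, clarify)
    fix V assume V: "open V" "A \<subseteq> V"
    have "m K + outer_content m (A - U) \<le> inner_content m V" if K: "compact K" "K \<subseteq> V \<inter> U" for K
    proof -
      \<comment> \<open>As \<open>K\<close> lies in \<open>U\<close>, the open set V - K still
        contains A - U.\<close>
      have "m K + outer_content m (A - U) \<le> m K + inner_content m (V - K)"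
        using V K by (intro add_left_mono outer_content_upper open_Diff) (auto intro: compact_imp_closed)
      also have "\<dots> = (SUP L\<in>{L. compact L \<and> L \<subseteq> V - K}. m K + m L)"
        unfolding inner_content_def by (rule ennreal_SUP_add_right) auto
      also have "\<dots> \<le> inner_content m V"
      proof (intro SUP_least, clarify)
        fix L assume L: "compact L" "L \<subseteq> V - K"
        then have "m K + m L = m (K \<union> L)" by (intro additive[symmetric]) auto
        also have "\<dots> \<le> inner_content m V"
          using K L by (intro inner_content_upper) (auto intro: compact_Un)
        finally show "m K + m L \<le> inner_content m V" .
      qed
      finally show ?thesis .
    qed
    then have "(SUP K\<in>{K. compact K \<and> K \<subseteq> V \<inter> U}. m K + outer_content m (A - U)) \<le> inner_content m V"
      by (intro SUP_least) auto
    moreover have "(SUP K\<in>{K. compact K \<and> K \<subseteq> V \<inter> U}. m K + outer_content m (A - U))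
        = inner_content m (V \<inter> U) + outer_content m (A - U)"
      unfolding inner_content_def by (rule ennreal_SUP_add_left) auto
    moreover have "outer_content m (A \<inter> U) \<le> inner_content m (V \<inter> U)"
      using U V by (intro outer_content_upper) auto
    ultimately show "outer_content m (A \<inter> U) + outer_content m (A - U) \<le> inner_content m V"
      by (auto intro: order_trans add_right_mono)
  qed
  moreover have "outer_content m A \<le> outer_content m (A \<inter> U) + outer_content m (A - U)" for A
  proof -
    interpret algebra UNIV "UNIV :: 'a set set"
      using algebra_Pow[of UNIV] by simp
    have "subadditive UNIV (outer_content m)"
      using outer_measure_space_outer_content
      by (intro countably_subadditive_subadditive) (auto simp: outer_measure_space_def)
    then have "outer_content m ((A \<inter> U) \<union> (A - U)) \<le> outer_content m (A \<inter> U) + outer_content m (A - U)"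
      by (rule subadditiveD) auto
    then show ?thesis by (simp add: Int_Diff_Un)
  qed
  ultimately have "outer_content m (A \<inter> U) + outer_content m (A - U) = outer_content m A" for A
    by (simp add: antisym)
  then show ?thesis
    by (simp add: lambda_system_def Int_commute Diff_eq)
qed

text \<open>Caratheodory's theorem: the measurable sets form a sigma-algebra that contains the open
  sets, hence all Borel sets.\<close>

lemma exists_borel_measure:
  obtains \<mu> where "sets \<mu> = sets borel" "\<And>A. A \<in> sets borel \<Longrightarrow> emeasure \<mu> A = outer_content m A"
proof -
  define L where "L = lambda_system UNIV UNIV (outer_content m)"
  interpret UNIV: sigma_algebra UNIV "UNIV :: 'a set set"
    using sigma_algebra_Pow[of UNIV] by simp
  have L: "measure_space UNIV L (outer_content m)"
    unfolding L_def using outer_measure_space_outer_content by (rule UNIV.caratheodory_lemma)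
  have "{U. open U} \<subseteq> L" using open_in_lambda_system by (auto simp: L_def)
  then have sub: "sets borel \<subseteq> L"
    using L by (simp add: measure_space_def sigma_algebra.sigma_sets_subset borel_def)
  have bor: "measure_space UNIV (sets borel) (outer_content m)"
    using sub L sets.sigma_algebra_axioms[of "borel :: 'a measure"]
    unfolding measure_space_def positive_def countably_additive_def by (auto simp: subset_eq)
  show thesis
  proof
    show "sets (measure_of UNIV (sets borel) (outer_content m)) = sets borel"
      using sets.sigma_sets_eq[of "borel :: 'a measure"] by simp
    show "emeasure (measure_of UNIV (sets borel) (outer_content m)) A = outer_content m A"
      if "A \<in> sets borel" for A
      using bor that by (intro emeasure_measure_of_sigma) (auto simp: measure_space_def)
  qed
qed

end

section \<open>Visit frequencies and their limit content\<close>

lemma visit_frequency_nonneg: "0 \<le> visit_frequency T x A k"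
  by (simp add: visit_frequency_def)

lemma visit_frequency_le_1: "visit_frequency T x A k \<le> 1"
proof -
  have "card {j \<in> {1..k}. (T ^^ j) x \<in> A} \<le> card {1..k}"
    by (intro card_mono) auto
  then show ?thesis by (simp add: visit_frequency_def divide_le_eq)
qed

lemma visit_frequency_Un:
  assumes "A \<inter> B = {}"
  shows "visit_frequency T x (A \<union> B) k = visit_frequency T x A k + visit_frequency T x B k"
proof -
  have "{j \<in> {1..k}. (T ^^ j) x \<in> A \<union> B}
      = {j \<in> {1..k}. (T ^^ j) x \<in> A} \<union> {j \<in> {1..k}. (T ^^ j) x \<in> B}"
    by auto
  then have "card {j \<in> {1..k}. (T ^^ j) x \<in> A \<union> B}
      = card {j \<in> {1..k}. (T ^^ j) x \<in> A} + card {j \<in> {1..k}. (T ^^ j) x \<in> B}"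
    using assms by (simp only:) (intro card_Un_disjoint; auto)
  then show ?thesis by (simp add: visit_frequency_def add_divide_distrib)
qed

text \<open>Visits to the preimage at times 1..k are visits to \<open>A\<close> at times 2..k+1. The
  two windows differ only in their end points, so the counts differ by at most one. For
  \<open>k = 0\<close> all quotients are 0.\<close>

lemma visit_frequency_vimage_diff:
  "\<bar>visit_frequency T x (T -` A) k - visit_frequency T x A k\<bar> \<le> 1 / real k"
proof -
  define S where "S = {j. (T ^^ j) x \<in> A}"
  have "card {j \<in> {1..k}. (T ^^ j) x \<in> T -` A} = card (Suc ` {j \<in> {1..k}. (T ^^ j) x \<in> T -` A})"
    by (simp add: card_image)
  also have "Suc ` {j \<in> {1..k}. (T ^^ j) x \<in> T -` A} = S \<inter> {2..Suc k}"
  proof (intro set_eqI iffI)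
    fix i assume "i \<in> S \<inter> {2..Suc k}"
    then show "i \<in> Suc ` {j \<in> {1..k}. (T ^^ j) x \<in> T -` A}"
      by (cases i) (auto simp: S_def)
  qed (auto simp: S_def)
  finally have eq: "card {j \<in> {1..k}. (T ^^ j) x \<in> T -` A} = card (S \<inter> {2..Suc k})" .
  have "card (S \<inter> {2..Suc k}) \<le> card (insert (Suc k) (S \<inter> {1..k}))"
    by (intro card_mono) auto
  also have "\<dots> \<le> Suc (card (S \<inter> {1..k}))" by (rule card_insert_le_m1) auto
  finally have 1: "card (S \<inter> {2..Suc k}) \<le> Suc (card (S \<inter> {1..k}))" .
  have "card (S \<inter> {1..k}) \<le> card (insert 1 (S \<inter> {2..Suc k}))"
    by (intro card_mono) auto
  also have "\<dots> \<le> Suc (card (S \<inter> {2..Suc k}))" by (rule card_insert_le_m1) auto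
  finally have 2: "card (S \<inter> {1..k}) \<le> Suc (card (S \<inter> {2..Suc k}))" .
  have "S \<inter> {1..k} = {j \<in> {1..k}. (T ^^ j) x \<in> A}" by (auto simp: S_def)
  then have "visit_frequency T x (T -` A) k - visit_frequency T x A k
      = (real (card (S \<inter> {2..Suc k})) - real (card (S \<inter> {1..k}))) / real k"
    unfolding visit_frequency_def eq by (simp only: diff_divide_distrib)
  moreover have "\<bar>real (card (S \<inter> {2..Suc k})) - real (card (S \<inter> {1..k}))\<bar> \<le> 1"
    using 1 2 by linarith
  ultimately show ?thesis by (simp add: divide_right_mono)
qed

text \<open>One filter \<open>G\<close> serves all sets \<open>A\<close> at once, so additivity
  passes to the limit, and the error 1/k in the invariance vanishes along \<open>G\<close>.\<close>

lemma exists_limit_visit_frequency: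
  obtains m G where "G \<noteq> bot" "G \<le> sequentially"
    "\<And>A. (visit_frequency T x A \<longlongrightarrow> m A) G"
    "content (\<lambda>A. ennreal (m A))" "\<And>A. m (T -` A) = m A"
proof -
  have "visit_frequency T x A k \<in> {0..1}" for A k
    by (simp add: visit_frequency_nonneg visit_frequency_le_1)
  then obtain m G where G: "G \<noteq> bot" "G \<le> sequentially"
    and lim: "\<And>A. ((\<lambda>k. visit_frequency T x A k) \<longlongrightarrow> m A) G"
    using convergent_subfilter_pointwise[of sequentially "\<lambda>_. {0..1}" "\<lambda>k A. visit_frequency T x A k"]
    by (metis compact_Icc sequentially_bot)
  have nonneg: "0 \<le> m A" for A
    using G(1) by (intro tendsto_lowerbound[OF lim] always_eventually) (auto simp: visit_frequency_nonneg)
  have add: "m (A \<union> B) = m A + m B" if "A \<inter> B = {}" for A B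
    using tendsto_unique[OF G(1) lim[of "A \<union> B"]] tendsto_add[OF lim[of A] lim[of B]]
      visit_frequency_Un[OF that, of T x] by simp
  have "m (A \<union> B) \<le> m A + m B" for A B
  proof -
    have "m (A \<union> B) = m A + m (B - A)"
      using add[of A "B - A"] by simp
    moreover have "m B = m (B \<inter> A) + m (B - A)"
      using add[of "B \<inter> A" "B - A"] by (simp add: Int_Diff_Un Int_Diff_disjoint)
    ultimately show ?thesis using nonneg[of "B \<inter> A"] by linarith
  qed
  moreover have "m {} = 0" using add[of "{}" "{}"] by simp
  ultimately have "content (\<lambda>A. ennreal (m A))"
    using add nonneg by unfold_locales (auto simp flip: ennreal_plus)
  moreover have "m (T -` A) = m A" for A
  proof -
    have "((\<lambda>k. visit_frequency T x (T -` A) k - visit_frequency T x A k) \<longlongrightarrow> 0) G"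
    proof (rule Lim_null_comparison)
      show "eventually (\<lambda>k. norm (visit_frequency T x (T -` A) k - visit_frequency T x A k) \<le> 1 / real k) G"
        using visit_frequency_vimage_diff[of T x A] by simp
      show "((\<lambda>k. 1 / real k) \<longlongrightarrow> 0) G"
        using lim_1_over_n[where 'a=real] G(2) by (rule tendsto_mono[rotated])
    qed
    then show ?thesis
      using tendsto_unique[OF G(1) _ tendsto_diff[OF lim[of "T -` A"] lim[of A]]] by fastforce
  qed
  ultimately show thesis using G lim that by blast
qed

section \<open>The invariant measure for a map continuous off a closed set\<close>

lemma exists_invariant_measure_if_rarely_near:
  fixes M H :: "'a::metric_space set"
  assumes M: "compact M" and T: "T \<in> M \<rightarrow> M" and H: "closed H" "H \<subseteq> M"
    and cont: "continuous_on (M - H) T" and x: "x \<in> M"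
    and freq: "((\<lambda>\<epsilon>. limsup (\<lambda>k. ereal (visit_frequency T x (nbhd_within M H \<epsilon>) k))) \<longlongrightarrow> 0) (at_right 0)"
  shows "\<exists>\<mu>. invariant_borel_probability M T \<mu>"
proof -
  obtain m G where G: "G \<noteq> bot" "G \<le> sequentially"
    and lim: "\<And>A. (visit_frequency T x A \<longlongrightarrow> m A) G"
    and "content (\<lambda>A. ennreal (m A))" and inv: "\<And>A. m (T -` A) = m A"
    using exists_limit_visit_frequency[of T x] by metis
  define c where "c A = ennreal (m A)" for A
  interpret content c unfolding c_def by fact
  obtain \<mu> where sets: "sets \<mu> = sets borel"
    and \<mu>: "\<And>A. A \<in> sets borel \<Longrightarrow> emeasure \<mu> A = outer_content c A"
    using exists_borel_measure by blast
  have \<mu>_open: "emeasure \<mu> U = inner_content c U" if "open U" for U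
    using that by (simp add: \<mu> outer_content_open)
  have \<mu>_open_le: "emeasure \<mu> U \<le> c U" if "open U" for U
    using inner_content_le that by (simp add: \<mu>_open)
  note [measurable_cong] = sets
  have space: "space \<mu> = UNIV" using sets_eq_imp_space_eq[OF sets] by simp
  have [measurable]: "M \<in> sets borel" "H \<in> sets borel"
    using M H by (auto intro: borel_closed compact_imp_closed)

  have orbit: "(T ^^ k) x \<in> M" for k
    by (induction k) (use x T in auto)
  have c_orbit: "c A = 1" if "M \<subseteq> A" for A
  proof -
    \<comment> \<open>This excludes \<open>k = 0\<close>, where the frequency has the default value
      0.\<close>
    have "eventually (\<lambda>k. k \<ge> 1) G"
      using eventually_ge_at_top G(2) by (rule filter_leD[rotated])
    then have "eventually (\<lambda>k. visit_frequency T x A k = 1) G"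
    proof eventually_elim
      case (elim k)
      have "{j \<in> {1..k}. (T ^^ j) x \<in> A} = {1..k}" using orbit that by auto
      then show ?case using elim by (simp add: visit_frequency_def)
    qed
    then have "(visit_frequency T x A \<longlongrightarrow> 1) G" by (rule tendsto_eventually)
    with lim G(1) have "m A = 1" by (metis tendsto_unique)
    then show ?thesis by (simp add: c_def)
  qed
  have c_compl: "c (- M) = 0"
    using additive[of M "- M"] c_orbit[of M] c_orbit[of UNIV] by simp
  have c_Int: "c A \<le> c (A \<inter> M)" for A
  proof -
    have "c A \<le> c (A \<inter> M) + c (A - M)"
      using subadditive[of "A \<inter> M" "A - M"] by (simp add: Int_Diff_Un)
    also have "c (A - M) \<le> c (- M)" by (rule mono) auto
    finally show ?thesis by (simp add: c_compl)
  qed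

  \<comment> \<open>No mass is lost in the regularisation: \<open>M\<close> itself is one of the
    compact sets in the supremum.\<close>
  have \<mu>_UNIV: "emeasure \<mu> UNIV = 1"
    using inner_content_upper[OF M, of UNIV c] \<mu>_open_le[of UNIV]
    by (simp add: \<mu>_open c_orbit antisym)
  interpret \<mu>: prob_space \<mu>
    by (rule prob_spaceI) (simp add: space \<mu>_UNIV)
  have \<mu>_compl: "- M \<in> null_sets \<mu>"
    using \<mu>_open_le[of "- M"] M by (auto simp: null_sets_def sets c_compl open_Compl compact_imp_closed)
  have \<mu>_H: "H \<in> null_sets \<mu>"
  proof -
    have "emeasure \<mu> H \<le> 0 + ennreal e" if "e > 0" for e
    proof -
      have "eventually (\<lambda>\<epsilon>. limsup (\<lambda>k. ereal (visit_frequency T x (nbhd_within M H \<epsilon>) k)) < e) (at_right 0)"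
        using freq that by (intro order_tendstoD(2)) auto
      then have "eventually (\<lambda>\<epsilon>. \<epsilon> > 0 \<and> limsup (\<lambda>k. ereal (visit_frequency T x (nbhd_within M H \<epsilon>) k)) < e) (at_right 0)"
        using eventually_at_right_less[of 0] by eventually_elim auto
      then obtain \<epsilon> where \<epsilon>: "\<epsilon> > 0" "limsup (\<lambda>k. ereal (visit_frequency T x (nbhd_within M H \<epsilon>) k)) < e"
        using eventually_happens trivial_limit_at_right_real by blast
      from Limsup_lessD[OF \<epsilon>(2)]
      have "eventually (\<lambda>k. visit_frequency T x (nbhd_within M H \<epsilon>) k \<le> e) sequentially"
        by eventually_elim simp
      then have "m (nbhd_within M H \<epsilon>) \<le> e"
        by (intro tendsto_upperbound[OF lim _ G(1)] filter_leD[OF G(2)])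
      \<comment> \<open>The estimate for open sets concerns the whole ambient space, whereas
        \<open>nbhd_within\<close> lies in \<open>M\<close>. \<open>V\<close> is an ambient open set
        with that trace on \<open>M\<close>, and \<open>c\<close> does not charge the rest.\<close>
      define V where "V = (\<Union>y\<in>H. ball y \<epsilon>)"
      have V: "open V" "H \<subseteq> V" using \<epsilon>(1) by (auto simp: V_def)
      then have "emeasure \<mu> H \<le> emeasure \<mu> V"
        by (intro emeasure_mono) (auto simp: sets)
      also have "\<dots> \<le> c V" using V(1) by (rule \<mu>_open_le)
      also have "\<dots> \<le> c (V \<inter> M)" by (rule c_Int)
      also have "V \<inter> M = nbhd_within M H \<epsilon>"
        by (auto simp: V_def nbhd_within_def dist_commute)
      also have "c \<dots> \<le> ennreal e"
        unfolding c_def by (rule ennreal_leI) fact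
      finally show ?thesis by simp
    qed
    then have "emeasure \<mu> H \<le> 0" using ennreal_le_epsilon[of 0 "emeasure \<mu> H"] by blast
    then show ?thesis by (simp add: null_sets_def sets)
  qed

  \<comment> \<open>A Borel map that agrees with \<open>T\<close> up to a \<open>\<mu>\<close>-null set; \<open>T\<close> itself need not be measurable on \<open>H\<close>.\<close>
  define T' where "T' p = (if p \<in> M - H then T p else x)" for p
  have [measurable]: "T' \<in> borel_measurable borel"
    unfolding T'_def using cont by (intro borel_measurable_continuous_on_if) auto
  have T'_T: "emeasure \<mu> (T' -` A) = emeasure \<mu> (T -` A \<inter> (M - H))"
    and T_sets: "T -` A \<inter> (M - H) \<in> sets borel" if A: "A \<in> sets borel" for A
  proof -
    have T'A: "T' -` A \<in> sets borel"
      using measurable_sets[of T' borel borel A] A by simp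
    have eq: "T -` A \<inter> (M - H) = T' -` A \<inter> (M - H)" by (auto simp: T'_def)
    show *: "T -` A \<inter> (M - H) \<in> sets borel" unfolding eq using T'A by auto
    have "T' -` A = T -` A \<inter> (M - H) \<union> T' -` A \<inter> (- M \<union> H)" unfolding eq by auto
    moreover have "T' -` A \<inter> (- M \<union> H) \<in> null_sets \<mu>"
      using \<mu>_H \<mu>_compl T'A by (intro null_set_Int1 null_sets.Un) (auto simp: sets)
    ultimately show "emeasure \<mu> (T' -` A) = emeasure \<mu> (T -` A \<inter> (M - H))"
      using * emeasure_Un_null_set sets by metis
  qed

  define \<nu> where "\<nu> = distr \<mu> borel T'"
  have \<nu>: "emeasure \<nu> A = emeasure \<mu> (T' -` A)" if "A \<in> sets borel" for A
    using that by (simp add: \<nu>_def emeasure_distr space)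
  interpret \<nu>: prob_space \<nu> unfolding \<nu>_def by (rule \<mu>.prob_space_distr) measurable
  \<comment> \<open>The preimage of \<open>U\<close> in M - H is only relatively open. It is
    enlarged to the ambient open set V - H, whose additional points lie outside
    \<open>M\<close>.\<close>
  have \<nu>_open_le: "emeasure \<nu> U \<le> emeasure \<mu> U" if U: "open U" for U
  proof -
    have "openin (top_of_set (M - H)) ((M - H) \<inter> T -` U)"
      using cont U by (rule continuous_openin_preimage_gen)
    then obtain V where V: "open V" "(M - H) \<inter> T -` U = (M - H) \<inter> V"
      unfolding openin_open by blast
    have "emeasure \<nu> U = emeasure \<mu> (T -` U \<inter> (M - H))"
      using U by (simp add: \<nu> T'_T)
    also have "\<dots> \<le> emeasure \<mu> (V - H)"
      using V H by (intro emeasure_mono) (auto simp: sets open_Diff)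
    also have "\<dots> = inner_content c (V - H)"
      using V H by (intro \<mu>_open open_Diff)
    also have "\<dots> \<le> inner_content c U"
      unfolding inner_content_def[of c "V - H"]
    proof (intro SUP_least, clarify)
      fix K assume K: "compact K" "K \<subseteq> V - H"
      \<comment> \<open>On this compact set \<open>T\<close> is continuous, so its image is a
        compact subset of \<open>U\<close> and competes in the supremum for
        \<open>U\<close>.\<close>
      have KM: "compact (K \<inter> M)" "K \<inter> M \<subseteq> M - H" "T ` (K \<inter> M) \<subseteq> U"
        using K M V by (auto intro: compact_Int_closed compact_imp_closed)
      have "c K \<le> c (K \<inter> M)" by (rule c_Int)
      also have "\<dots> \<le> c (T -` T ` (K \<inter> M))" by (rule mono) auto
      also have "\<dots> = c (T ` (K \<inter> M))" by (simp add: c_def inv)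
      also have "\<dots> \<le> inner_content c U"
        using KM cont by (intro inner_content_upper compact_continuous_image) (auto intro: continuous_on_subset)
      finally show "c K \<le> inner_content c U" .
    qed
    finally show ?thesis using U by (simp add: \<mu>_open)
  qed
  \<comment> \<open>The value of \<mu> at \<open>A\<close> is by construction an infimum over open
    supersets, each of which also bounds \<nu>.\<close>
  have \<nu>_le: "emeasure \<nu> A \<le> emeasure \<mu> A" if A: "A \<in> sets borel" for A
  proof -
    have "emeasure \<nu> A \<le> inner_content c U" if "open U" "A \<subseteq> U" for U
    proof -
      have "emeasure \<nu> A \<le> emeasure \<nu> U"
        using that by (intro emeasure_mono) (auto simp: \<nu>_def)
      with \<nu>_open_le[OF that(1)] show ?thesis using that by (simp add: \<mu>_open)
    qed
    then show ?thesis
      unfolding \<mu>[OF A] outer_content_def by (intro INF_greatest) auto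
  qed
  \<comment> \<open>One inequality suffices because both measures have the same total mass.\<close>
  have \<nu>_eq: "emeasure \<nu> A = emeasure \<mu> A" if A: "A \<in> sets borel" for A
  proof -
    have le: "measure \<nu> B \<le> measure \<mu> B" if "B \<in> sets borel" for B
      using \<nu>_le[OF that] by (simp add: \<mu>.emeasure_eq_measure \<nu>.emeasure_eq_measure)
    have "measure \<nu> (- A) = 1 - measure \<nu> A" "measure \<mu> (- A) = 1 - measure \<mu> A"
      using \<nu>.prob_compl[of A] \<mu>.prob_compl[of A] A
      by (simp_all add: sets space \<nu>_def Compl_eq_Diff_UNIV)
    with le[of A] le[of "- A"] A have "measure \<nu> A = measure \<mu> A" by auto
    then show ?thesis by (simp add: \<mu>.emeasure_eq_measure \<nu>.emeasure_eq_measure)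
  qed

  define N where "N = restrict_space \<mu> M"
  have sets_N: "A \<in> sets N \<longleftrightarrow> A \<in> sets borel \<and> A \<subseteq> M" for A
    by (auto simp: N_def sets_restrict_space_iff space sets)
  have N: "emeasure N A = emeasure \<mu> A" if "A \<subseteq> M" for A
    using that unfolding N_def by (intro emeasure_restrict_space) (auto simp: space sets)
  have "emeasure \<mu> M = 1"
  proof -
    have "emeasure \<mu> (M \<union> - M) = emeasure \<mu> M"
      using \<mu>_compl by (intro emeasure_Un_null_set) (auto simp: sets)
    then show ?thesis by (simp add: \<mu>_UNIV)
  qed
  then have "prob_space N"
    unfolding N_def by (intro prob_space_restrict_space) (auto simp: sets)
  moreover have "sets N = sets (restrict_space borel M)"
    unfolding N_def using sets by (rule sets_restrict_space_cong)
  moreover have "T -` A \<inter> M \<in> sets (completion N) \<and> emeasure (completion N) (T -` A \<inter> M) = emeasure N A"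
    if "A \<in> sets N" for A
  proof -
    have A: "A \<in> sets borel" "A \<subseteq> M" using that by (auto simp: sets_N)
    let ?S = "T -` A \<inter> (M - H)"
    \<comment> \<open>The first part is Borel. The second is an arbitrary subset of the null set
      \<open>H\<close>, hence measurable and null in the completion.\<close>
    have eq: "T -` A \<inter> M = ?S \<union> T -` A \<inter> H" using H by auto
    have S: "?S \<in> sets N" using T_sets A by (auto simp: sets_N)
    have "H \<in> null_sets N"
      using \<mu>_H H by (auto simp: null_sets_def sets_N N)
    then have null: "T -` A \<inter> H \<in> null_sets (completion N)"
      unfolding null_sets_completion_iff2 by blast
    have "emeasure (completion N) (T -` A \<inter> M) = emeasure (completion N) ?S"
      unfolding eq using S null by (intro emeasure_Un_null_set) auto
    also have "\<dots> = emeasure \<mu> ?S" using S by (simp add: N sets_N)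
    also have "\<dots> = emeasure N A"
      using \<nu>_eq[OF A(1)] \<nu>[OF A(1)] T'_T[OF A(1)] A(2) by (simp add: N)
    finally show ?thesis
      unfolding eq using S null by auto
  qed
  ultimately show ?thesis
    unfolding invariant_borel_probability_def by blast
qed

section \<open>Piecewise continuous maps\<close>

text \<open>An open domain misses its own frontier. It also misses the closure, hence the frontier,
  of any domain disjoint from it. The closures therefore add nothing but frontier points.\<close>

lemma domain_decomposition_Diff_discontinuity_set:
  assumes "domain_decomposition E M n D"
  shows "M - discontinuity_set E n D = (\<Union>j\<in>{1..n}. D j)"
proof -
  have D: "openin (top_of_set E) (D j)" if "j \<in> {1..n}" for j
    using assms that by (auto simp: domain_decomposition_def)
  have closure: "top_of_set E closure_of D j = D j \<union> top_of_set E frontier_of D j" if "j \<in> {1..n}" for j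
    using D[OF that] interior_of_union_frontier_of[of "top_of_set E" "D j"]
    by (simp add: interior_of_openin)
  have "D i \<inter> top_of_set E frontier_of D j = {}" if ij: "i \<in> {1..n}" "j \<in> {1..n}" for i j
  proof (cases "i = j")
    case True
    then show ?thesis using D ij by (simp add: frontier_of_openin)
  next
    case False
    then have "D i \<inter> D j = {}"
      using assms ij by (auto simp: domain_decomposition_def disjoint_family_on_def)
    then have "D i \<inter> top_of_set E closure_of D j = {}"
      using D[OF ij(1)] by (simp add: openin_Int_closure_of_eq_empty)
    then show ?thesis by (auto simp: frontier_of_def)
  qed
  then have "(\<Union>j\<in>{1..n}. D j) \<inter> discontinuity_set E n D = {}"
    unfolding discontinuity_set_def by blast
  moreover have "M = (\<Union>j\<in>{1..n}. D j) \<union> discontinuity_set E n D"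
    using assms closure by (auto simp: domain_decomposition_def discontinuity_set_def)
  ultimately show ?thesis by blast
qed

text \<open>Common to manifolds and Euclidean subsets. Closedness of \<open>E\<close> turns the
  relatively closed discontinuity set into a closed one.\<close>

lemma exists_invariant_measure_piecewise_continuous:
  assumes M: "compact M" and E: "closed E" "M \<subseteq> E"
    and D: "domain_decomposition E M n D" and T: "piecewise_continuous M n D T"
    and x: "x \<in> M"
    and freq: "((\<lambda>\<epsilon>. limsup (\<lambda>k. ereal (visit_frequency T x
        (nbhd_within M (discontinuity_set E n D) \<epsilon>) k))) \<longlongrightarrow> 0) (at_right 0)"
  shows "\<exists>\<mu>. invariant_borel_probability M T \<mu>"
proof (rule exists_invariant_measure_if_rarely_near[OF M _ _ _ _ x freq])
  let ?H = "discontinuity_set E n D"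
  show "T \<in> M \<rightarrow> M" using T by (simp add: piecewise_continuous_def)
  have "closedin (top_of_set E) ?H"
    unfolding discontinuity_set_def by (intro closedin_Union) (auto simp: closedin_frontier_of)
  then show "closed ?H" using E(1) by (rule closedin_closed_trans)
  show "?H \<subseteq> M"
    using D by (auto simp: domain_decomposition_def discontinuity_set_def frontier_of_def)
  have eq: "M - ?H = (\<Union>j\<in>{1..n}. D j)"
    using D by (rule domain_decomposition_Diff_discontinuity_set)
  \<comment> \<open>The domains form a relatively open cover of M - H, so continuity on each of them
    gives continuity on their union.\<close>
  have "continuous_map (top_of_set (M - ?H)) euclidean T"
  proof (rule pasting_lemma[where I = "{1..n}" and T = D and f = "\<lambda>_. T"])
    fix j assume j: "j \<in> {1..n}"
    have sub: "D j \<subseteq> M - ?H" using j by (auto simp: eq)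
    show "openin (top_of_set (M - ?H)) (D j)"
    proof (rule openin_subset_trans[OF _ sub])
      show "openin (top_of_set E) (D j)"
        using D j unfolding domain_decomposition_def by blast
      show "M - ?H \<subseteq> E"
        using E(2) by blast
    qed
    show "continuous_map (subtopology (top_of_set (M - ?H)) (D j)) euclidean T"
      using T j sub by (simp add: subtopology_subtopology Int_absorb1 piecewise_continuous_def)
  qed (auto simp: eq)
  then show "continuous_on (M - ?H) T" by simp
qed

theorem theorem3p1:
  shows
    "(\<forall>(M :: 'a::metric_space set) (\<A> :: ('a, 'd::finite) chart set) g n D T.
        compact_riemannian_manifold M \<A> g \<longrightarrow>
        domain_decomposition M M n D \<longrightarrow>
        piecewise_continuous M n D T \<longrightarrow>
        (\<exists>x \<in> M - preimages_union M T (discontinuity_set M n D).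
           ((\<lambda>\<epsilon>. limsup (\<lambda>m. ereal (visit_frequency T x
                (nbhd_within M (discontinuity_set M n D) \<epsilon>) m))) \<longlongrightarrow> 0) (at_right 0)) \<longrightarrow>
        (\<exists>\<mu>. invariant_borel_probability M T \<mu>))
     \<and>
     (\<forall>(M :: (real ^ 'd) set) n D T.
        bounded M \<longrightarrow>
        domain_decomposition UNIV M n D \<longrightarrow>
        piecewise_continuous M n D T \<longrightarrow>
        (\<exists>x \<in> M - preimages_union M T (discontinuity_set UNIV n D).
           ((\<lambda>\<epsilon>. limsup (\<lambda>m. ereal (visit_frequency T x
                (nbhd_within M (discontinuity_set UNIV n D) \<epsilon>) m))) \<longlongrightarrow> 0) (at_right 0)) \<longrightarrow>
        (\<exists>\<mu>. invariant_borel_probability M T \<mu>))"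
proof (intro conjI allI impI)
  fix M :: "'a set" and \<A> :: "('a, 'd) chart set" and g n D T
  assume "compact_riemannian_manifold M \<A> g"
  then have "compact M" by (simp add: compact_riemannian_manifold_def)
  moreover assume "domain_decomposition M M n D" "piecewise_continuous M n D T"
    "\<exists>x \<in> M - preimages_union M T (discontinuity_set M n D).
       ((\<lambda>\<epsilon>. limsup (\<lambda>m. ereal (visit_frequency T x
            (nbhd_within M (discontinuity_set M n D) \<epsilon>) m))) \<longlongrightarrow> 0) (at_right 0)"
  ultimately show "\<exists>\<mu>. invariant_borel_probability M T \<mu>"
    using exists_invariant_measure_piecewise_continuous[of M M n D T] compact_imp_closed by auto
next
  fix M :: "(real ^ 'd) set" and n D T
  assume M: "bounded M" "domain_decomposition UNIV M n D"
    and "piecewise_continuous M n D T"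
    "\<exists>x \<in> M - preimages_union M T (discontinuity_set UNIV n D).
       ((\<lambda>\<epsilon>. limsup (\<lambda>m. ereal (visit_frequency T x
            (nbhd_within M (discontinuity_set UNIV n D) \<epsilon>) m))) \<longlongrightarrow> 0) (at_right 0)"
  \<comment> \<open>A finite union of closures is closed, so Heine-Borel applies.\<close>
  moreover have "compact M"
    using M by (auto simp: domain_decomposition_def compact_eq_bounded_closed)
  ultimately show "\<exists>\<mu>. invariant_borel_probability M T \<mu>"
    using exists_invariant_measure_piecewise_continuous[of M UNIV n D T] compact_imp_closed by auto
qed

end
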